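(* Let $\Delta_4=\prod_{i=1}^{\infty}(1-4^{-i})$. Then, as $n\to\infty$, \[ \operatorname{La}(n,Q_2)\ \ge\ \left(2+\frac{29}{135}\,\Delta_4+o(1)\right)\binom{n}{\lfloor n/2\rfloor}. \] The coefficient $2+\frac{29}{135}\Delta_4$ is approximately $2.147908$.
   Context: $[n]=\{1,2,\dots,n\}$, and $2^{[n]}$ denotes the family of all subsets of $[n]$, ordered by inclusion. For a finite poset $P$, a family $\mathcal F\subseteq 2^{[n]}$ contains a weak copy of $P$ if there is an injective map $\psi\colon P\to\mathcal F$ such that $\psi(p)\subset\psi(q)$ whenever $p<q$ in $P$. Define $\operatorname{La}(n,P)=\max\{|\mathcal F| : \mathcal F\subseteq 2^{[n]}\text{ contains no weak copy of }P\}$. The diamond poset $Q_2$ is the Boolean lattice of dimension $2$: it has four elements $b,x,y,c$ with $b<x<c$ and $b<y<c$, where $x$ and $y$ are incomparable. The term $o(1)$ denotes a quantity depending only on $n$ that tends to $0$ as $n\to\infty$. *)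

theory Defs
  imports "HOL-Analysis.Analysis"
begin

text \<open>
  A finite poset is a type of class \<open>{finite, order}\<close>. On sets, \<open>(<)\<close> is proper inclusion,
  so \<^term>\<open>strict_mono\<close> is the condition that \<open>p < q\<close> implies \<open>\<psi> p \<subset> \<psi> q\<close>; incomparable
  elements may be sent to comparable sets.
\<close>

definition contains_weak_copy :: "nat set set \<Rightarrow> 'p::{finite,order} itself \<Rightarrow> bool" where
  "contains_weak_copy F P \<longleftrightarrow>
     (\<exists>\<psi> :: 'p \<Rightarrow> nat set. inj \<psi> \<and> range \<psi> \<subseteq> F \<and> strict_mono \<psi>)"

definition La :: "nat \<Rightarrow> 'p::{finite,order} itself \<Rightarrow> nat" where
  "La n P = Max (card ` {F. F \<subseteq> Pow {1..n} \<and> \<not> contains_weak_copy F P})"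

text \<open>The maximum is taken over a finite nonempty set.\<close>

lemma La_family_finite_nonempty:
  fixes P :: "'p::{finite,order} itself"
  shows "finite {F. F \<subseteq> Pow {1..n} \<and> \<not> contains_weak_copy F P}"
    and "{F. F \<subseteq> Pow {1..n} \<and> \<not> contains_weak_copy F P} \<noteq> {}"
proof -
  show "finite {F. F \<subseteq> Pow {1..n} \<and> \<not> contains_weak_copy F P}"
    by (rule finite_subset[of _ "Pow (Pow {1..n})"]) auto
  have "\<not> contains_weak_copy {} P"
    by (simp add: contains_weak_copy_def)
  then show "{F. F \<subseteq> Pow {1..n} \<and> \<not> contains_weak_copy F P} \<noteq> {}"
    by blast
qed

datatype diamond = D_b | D_x | D_y | D_c

instantiation diamond :: order
begin

definition less_eq_diamond :: "diamond \<Rightarrow> diamond \<Rightarrow> bool" where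
  "p \<le> q \<longleftrightarrow> p = q \<or> p = D_b \<or> q = D_c"

definition less_diamond :: "diamond \<Rightarrow> diamond \<Rightarrow> bool" where
  "p < q \<longleftrightarrow> p \<le> q \<and> p \<noteq> (q :: diamond)"

instance
  by standard (auto simp: less_eq_diamond_def less_diamond_def)

end

instance diamond :: finite
proof
  have "(UNIV :: diamond set) = {D_b, D_x, D_y, D_c}"
    using diamond.exhaust by auto
  then show "finite (UNIV :: diamond set)"
    by (metis finite.emptyI finite_insert)
qed

text \<open>The index of \<^term>\<open>prodinf\<close> starts at \<open>0\<close>, hence the shift of the exponent.\<close>

definition Delta4 :: real where
  "Delta4 = (\<Prod>i. 1 - 1 / 4 ^ Suc i)"

lemma Delta4_has_prod: "(\<lambda>i. 1 - 1 / 4 ^ Suc i :: real) has_prod Delta4"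
proof -
  have "summable (\<lambda>i. 1 / 4 * (1 / 4) ^ i :: real)"
    by (intro summable_mult summable_geometric) simp
  then have "summable (\<lambda>i. norm (1 - 1 / 4 ^ Suc i - 1 :: real))"
    by (simp add: power_one_over)
  then have "convergent_prod (\<lambda>i. 1 - 1 / 4 ^ Suc i :: real)"
    by (intro abs_convergent_prod_imp_convergent_prod summable_imp_abs_convergent_prod)
  then show ?thesis
    unfolding Delta4_def by (rule convergent_prod_has_prod)
qed

end

theory Submission
  imports Defs "HOL-Library.Function_Algebras" "HOL-Real_Asymp.Real_Asymp"
begin

text \<open>
  Attach to each \<open>i \<in> {1..n}\<close> a vector of a space of dimension \<open>d = n div 2\<close> over the field with
  \<open>q = 4\<close> elements. The nullity of a set \<open>S\<close> of indices is the dimension of the space of linear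
  relations among the vectors with index in \<open>S\<close>. Take

  \<^item> the sets of size \<open>d - 1\<close> whose nullity is not \<open>1\<close>,
  \<^item> the sets of size \<open>d\<close> whose nullity is not \<open>0\<close>,
  \<^item> the sets of size \<open>d + 1\<close> whose nullity is \<open>1\<close>.

  There is no diamond \<open>A \<subset> X, Y \<subset> C\<close> among them, whatever the vectors are. Up to scaling \<open>C\<close>
  carries a single relation. As \<open>X\<close> and \<open>Y\<close> carry nonzero relations and lie in \<open>C\<close>, both contain
  the support of that relation. Then so does \<open>A = X \<inter> Y\<close>, whose nullity is therefore \<open>1\<close>, which is
  excluded (\<open>rank_family_diamond_free\<close>).

  For the size, choose the vectors at random. By \<open>card_assignments_by_nullity\<close> the probability that
  a set has nullity \<open>0\<close> or \<open>1\<close> depends only on its size, and tends to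
  \<open>\<Delta> / ((1 - 1/4) * (1 - 1/16)) * (1/12) = 16/135 * \<Delta>\<close> for nullity \<open>1\<close> on the lower layer, to \<open>\<Delta>\<close>
  for nullity \<open>0\<close> on the middle layer and to \<open>4/3 * \<Delta>\<close> for nullity \<open>1\<close> on the upper layer, where
  \<open>\<Delta> = Delta4\<close>. All three layers have asymptotically \<open>n choose d\<close> elements, so the expected size is
  asymptotically
  \<open>(1 - 16/135 * \<Delta>) + (1 - \<Delta>) + 4/3 * \<Delta> = 2 + 29/135 * \<Delta>\<close> times \<open>n choose d\<close>, and some choice of
  vectors does at least as well as the average (\<open>exists_large_rank_family\<close>).

  Nullity is measured throughout by the number of relations, which is \<open>q\<close> to the power of the
  nullity: nullity \<open>0\<close> means exactly one relation, and nullity \<open>1\<close> means exactly \<open>q\<close>. The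
  construction makes sense over any finite field; \<open>q = 4\<close> gives the largest limit.
\<close>

section \<open>The field with four elements\<close>

text \<open>
  \<open>GF4 a b\<close> is \<open>a + b * \<omega>\<close>, where \<open>a\<close> and \<open>b\<close> are bits and \<open>\<omega>\<^sup>2 = \<omega> + 1\<close>. The multiplicative group
  has order \<open>3\<close>, so the inverse of \<open>x \<noteq> 0\<close> is \<open>x\<^sup>2 = (a + b) + b * \<omega>\<close>.
\<close>

datatype gf4 = GF4 bool bool

instantiation gf4 :: field
begin

definition "0 = GF4 False False"
definition "1 = GF4 True False"
definition "- x = (x :: gf4)"
fun plus_gf4 where "GF4 a b + GF4 c d = GF4 (a \<noteq> c) (b \<noteq> d)"
definition "x - y = x + (y :: gf4)"
fun times_gf4 where
  "GF4 a b * GF4 c d = GF4 ((a \<and> c) \<noteq> (b \<and> d)) (((a \<and> d) \<noteq> (b \<and> c)) \<noteq> (b \<and> d))"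
fun inverse_gf4 where "inverse (GF4 a b) = GF4 (a \<noteq> b) b"
definition "x div y = x * inverse (y :: gf4)"

instance
proof
  fix x y z :: gf4
  show "x + y + z = x + (y + z)" by (cases x; cases y; cases z) auto
  show "x + y = y + x" by (cases x; cases y) auto
  show "0 + x = x" by (cases x) (auto simp: zero_gf4_def)
  show "- x + x = 0" by (cases x) (auto simp: zero_gf4_def uminus_gf4_def)
  show "x - y = x + - y" by (simp add: minus_gf4_def uminus_gf4_def)
  show "x * y * z = x * (y * z)" by (cases x; cases y; cases z) auto
  show "x * y = y * x" by (cases x; cases y) auto
  show "1 * x = x" by (cases x) (auto simp: one_gf4_def)
  show "(x + y) * z = x * z + y * z" by (cases x; cases y; cases z) auto
  show "(0::gf4) \<noteq> 1" by (simp add: zero_gf4_def one_gf4_def)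
  show "inverse x * x = 1" if "x \<noteq> 0"
    using that by (cases x) (auto simp: zero_gf4_def one_gf4_def)
  show "x div y = x * inverse y" by (simp add: divide_gf4_def)
  show "inverse (0::gf4) = 0" by (simp add: zero_gf4_def)
qed

end

lemma UNIV_gf4: "(UNIV :: gf4 set) = case_prod GF4 ` UNIV"
proof -
  have "x \<in> case_prod GF4 ` UNIV" for x
    by (cases x) auto
  then show ?thesis by blast
qed

instance gf4 :: finite
  by standard (simp add: UNIV_gf4)

lemma card_gf4: "CARD(gf4) = 4"
proof -
  have "inj (case_prod GF4)" by (auto simp: inj_def)
  then have "CARD(gf4) = CARD(bool \<times> bool)"
    unfolding UNIV_gf4 by (rule card_image)
  then show ?thesis by simp
qed

section \<open>Counting functions on a finite set\<close>

lemma card_PiE_insert_filter: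
  assumes "x \<notin> S" "finite S" "finite V"
  shows "card {v \<in> insert x S \<rightarrow>\<^sub>E V. P v} = (\<Sum>g\<in>S \<rightarrow>\<^sub>E V. card {y \<in> V. P (g(x := y))})"
proof -
  have "bij_betw (\<lambda>(g, y). g(x := y)) (SIGMA g:S \<rightarrow>\<^sub>E V. {y \<in> V. P (g(x := y))})
          {v \<in> insert x S \<rightarrow>\<^sub>E V. P v}"
    using assms(1)
    by (intro bij_betw_byWitness[where f' = "\<lambda>v. (v(x := undefined), v x)"])
       (auto simp: PiE_def extensional_def fun_eq_iff)
  then have "card {v \<in> insert x S \<rightarrow>\<^sub>E V. P v}
      = card (SIGMA g:S \<rightarrow>\<^sub>E V. {y \<in> V. P (g(x := y))})"
    by (rule bij_betw_same_card[symmetric])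
  also have "\<dots> = (\<Sum>g\<in>S \<rightarrow>\<^sub>E V. card {y \<in> V. P (g(x := y))})"
    using assms by (intro card_SigmaI) (auto intro: finite_PiE)
  finally show ?thesis .
qed

text \<open>
  Independence of the coordinates: an event that only looks at the coordinates in \<open>S\<close> keeps its
  probability when further coordinates are drawn.
\<close>

lemma card_PiE_filter_local:
  assumes "finite S" "finite T" "S \<inter> T = {}" "finite V"
    and local: "\<And>v v'. (\<And>i. i \<in> S \<Longrightarrow> v i = v' i) \<Longrightarrow> P v = P v'"
  shows "card {v \<in> S \<union> T \<rightarrow>\<^sub>E V. P v} = card V ^ card T * card {v \<in> S \<rightarrow>\<^sub>E V. P v}"
  using assms(2,3)
proof (induction T)
  case (insert y T)
  have "card {v \<in> S \<union> insert y T \<rightarrow>\<^sub>E V. P v}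
      = (\<Sum>g\<in>S \<union> T \<rightarrow>\<^sub>E V. card {z \<in> V. P (g(y := z))})"
    using insert assms(1,4) card_PiE_insert_filter[of y "S \<union> T" V P] by auto
  also have "\<dots> = (\<Sum>g\<in>S \<union> T \<rightarrow>\<^sub>E V. if P g then card V else 0)"
  proof (rule sum.cong)
    fix g
    have "P (g(y := z)) = P g" for z
      using insert.prems by (intro local) auto
    then show "card {z \<in> V. P (g(y := z))} = (if P g then card V else 0)" by simp
  qed simp
  also have "\<dots> = card V * card {g \<in> S \<union> T \<rightarrow>\<^sub>E V. P g}"
    using assms(1,4) insert.hyps by (simp add: finite_PiE flip: sum.inter_filter)
  finally show ?case using insert by simp
qed simp

section \<open>Nullity of random tuples\<close>

text \<open>
  Let \<open>m\<close> vectors be drawn independently and uniformly from a space with \<open>Q\<close> elements over a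
  field with \<open>q\<close> elements. The next two functions are the probabilities that the space of linear
  relations among them has dimension \<open>0\<close> and \<open>1\<close>. In the first case each vector avoids the
  \<open>q ^ i\<close> vectors spanned by its \<open>i\<close> predecessors. In the second case exactly one vector fails to do
  so: if it has \<open>i\<close> predecessors, this costs a factor \<open>q ^ i / Q\<close>, and the other \<open>m - 1\<close> vectors
  contribute the same product whatever \<open>i\<close> is, so that \<open>\<Sum>i<m. q ^ i\<close> comes out as a factor.
\<close>

definition independence_density :: "real \<Rightarrow> real \<Rightarrow> nat \<Rightarrow> real" where
  "independence_density q Q m = (\<Prod>i<m. 1 - q ^ i / Q)"

fun nullity_one_density :: "real \<Rightarrow> real \<Rightarrow> nat \<Rightarrow> real" where
  "nullity_one_density q Q 0 = 0"
| "nullity_one_density q Q (Suc m) =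
     independence_density q Q m * ((q ^ Suc m - 1) / ((q - 1) * Q))"

text \<open>
  One more draw keeps the nullity at \<open>1\<close> or raises it from \<open>0\<close> to \<open>1\<close>. The span that the new vector
  has to avoid, respectively to hit, has \<open>q ^ m / q\<close>, respectively \<open>q ^ m\<close>, elements.
\<close>

lemma nullity_one_density_step:
  assumes "q > 1" "Q > 0"
  shows "Q * nullity_one_density q Q (Suc m) =
    q ^ m * independence_density q Q m + (Q - q ^ m / q) * nullity_one_density q Q m"
proof (cases m)
  case (Suc j)
  define E where "E = independence_density q Q j"
  have step: "independence_density q Q (Suc j) = E * (1 - q ^ j / Q)"
    by (simp add: independence_density_def E_def)
  show ?thesis
    unfolding Suc nullity_one_density.simps step E_def[symmetric]
    using assms by (simp add: field_simps)
qed (use assms in \<open>simp add: independence_density_def\<close>)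

section \<open>Linear relations among the vectors of a family\<close>

definition supported_on :: "'i set \<Rightarrow> ('i \<Rightarrow> 'a::zero) set" where
  "supported_on S = {w. \<forall>i. i \<notin> S \<longrightarrow> w i = 0}"

lemma bij_betw_supported_on_insert:
  assumes "x \<notin> S"
  shows "bij_betw (\<lambda>(c, w). w(x := c)) (UNIV \<times> supported_on S)
           (supported_on (insert x S) :: ('i \<Rightarrow> 'a::zero) set)"
proof (rule bij_betw_byWitness[where f' = "\<lambda>w. (w x, w(x := 0))"])
  show "\<forall>a\<in>UNIV \<times> supported_on S.
      (\<lambda>w. (w x, w(x := 0))) (case a of (c, w) \<Rightarrow> w(x := c)) = (a :: 'a \<times> ('i \<Rightarrow> 'a))"
    using assms by (auto simp: supported_on_def fun_eq_iff)
qed (auto simp: supported_on_def)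

lemma card_supported_on:
  assumes "finite S"
  shows "finite (supported_on S :: ('i \<Rightarrow> 'a::{zero,finite}) set)"
    and "card (supported_on S :: ('i \<Rightarrow> 'a) set) = CARD('a) ^ card S"
  using assms
proof (induction S)
  case empty
  have *: "supported_on {} = {\<lambda>_::'i. 0 :: 'a}"
    by (auto simp: supported_on_def)
  {
    case 1 show ?case by (simp add: *)
  next
    case 2 show ?case by (simp add: *)
  }
next
  case (insert x S)
  note bij = bij_betw_supported_on_insert[OF insert.hyps(2), where 'a='a]
  {
    case 1 show ?case
      using bij_betw_finite[OF bij] insert.IH(1) by simp
  next
    case 2 show ?case
      using bij_betw_same_card[OF bij] insert by (simp add: card_cartesian_product)
  }
qed

locale finite_vector_space = vector_space scale
  for scale :: "'a::{field,finite} \<Rightarrow> 'b::ab_group_add \<Rightarrow> 'b" (infixr \<open>*s\<close> 75) +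
  fixes V :: "'b set"
  assumes finite_V: "finite V" and subspace_V: "subspace V"
begin

abbreviation Q :: real where "Q \<equiv> real (card V)"

lemma card_field_gt_1: "CARD('a) > 1"
proof -
  have "card {0, 1 :: 'a} \<le> CARD('a)" by (rule card_mono) auto
  then have "2 \<le> CARD('a)" by simp
  then show ?thesis by linarith
qed

lemma Q_pos: "Q > 0"
  using finite_V subspace_0[OF subspace_V] by (auto simp: card_gt_0_iff)

text \<open>
  The family \<open>v\<close> need not be injective, so coefficients are attached to indices and not to vectors.
  Coefficients outside \<open>S\<close> are zero, which makes relations on different index sets comparable as
  functions.
\<close>

definition representations :: "('i \<Rightarrow> 'b) \<Rightarrow> 'i set \<Rightarrow> 'b \<Rightarrow> ('i \<Rightarrow> 'a) set" where
  "representations v S u = {w \<in> supported_on S. (\<Sum>i\<in>S. w i *s v i) = u}"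

abbreviation relations :: "('i \<Rightarrow> 'b) \<Rightarrow> 'i set \<Rightarrow> ('i \<Rightarrow> 'a) set" where
  "relations v S \<equiv> representations v S 0"

definition combinations :: "('i \<Rightarrow> 'b) \<Rightarrow> 'i set \<Rightarrow> 'b set" where
  "combinations v S = {u. representations v S u \<noteq> {}}"

lemma finite_representations: "finite S \<Longrightarrow> finite (representations v S u)"
  unfolding representations_def
  by (rule finite_subset[OF _ card_supported_on(1)]) auto

lemma representations_cong:
  "(\<And>i. i \<in> S \<Longrightarrow> v i = v' i) \<Longrightarrow> representations v S u = representations v' S u"
  by (simp add: representations_def cong: sum.cong)

lemma zero_in_relations: "(\<lambda>_. 0) \<in> relations v S"
  by (simp add: representations_def supported_on_def)

lemma relations_mono:
  assumes "finite T" "S \<subseteq> T"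
  shows "relations v S = relations v T \<inter> supported_on S"
proof -
  have "(\<Sum>i\<in>T. w i *s v i) = (\<Sum>i\<in>S. w i *s v i)" if "w \<in> supported_on S" for w
    using that assms by (intro sum.mono_neutral_right) (auto simp: supported_on_def)
  then show ?thesis
    using assms by (auto simp: representations_def supported_on_def)
qed

lemma card_relations_pos: "finite S \<Longrightarrow> card (relations v S) > 0"
  using finite_representations zero_in_relations by (metis card_gt_0_iff empty_iff)

text \<open>The representations of \<open>u\<close> form a coset of the space of relations.\<close>

lemma card_representations:
  assumes "finite S" "u \<in> combinations v S"
  shows "card (representations v S u) = card (relations v S)"
proof -
  obtain w0 where w0: "w0 \<in> representations v S u"
    using assms unfolding combinations_def by blast
  have "bij_betw (\<lambda>w i. w i + w0 i) (relations v S) (representations v S u)"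
    using w0
    by (intro bij_betw_byWitness[where f' = "\<lambda>w i. w i - w0 i"])
       (auto simp: representations_def supported_on_def scale_left_distrib
          scale_left_diff_distrib sum.distrib sum_subtractf)
  then show ?thesis by (rule bij_betw_same_card[symmetric])
qed

text \<open>
  Rank and nullity: every coefficient vector supported on \<open>S\<close> represents exactly one combination,
  and every combination has equally many representations.
\<close>

lemma card_combinations:
  fixes S :: "'i set"
  assumes "finite S"
  shows "card (combinations v S) * card (relations v S) = CARD('a) ^ card S"
proof -
  have fin: "finite (supported_on S :: ('i \<Rightarrow> 'a) set)"
    using assms by (rule card_supported_on)
  have img: "combinations v S = (\<lambda>w. \<Sum>i\<in>S. w i *s v i) ` supported_on S"
    by (auto simp: combinations_def representations_def)
  have "card (supported_on S :: ('i \<Rightarrow> 'a) set)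
      = card (\<Union>u\<in>combinations v S. representations v S u)"
    by (rule arg_cong[where f = card]) (auto simp: combinations_def representations_def)
  also have "\<dots> = (\<Sum>u\<in>combinations v S. card (representations v S u))"
    using fin assms
    by (intro card_UN_disjoint) (auto simp: img finite_representations, auto simp: representations_def)
  also have "\<dots> = card (combinations v S) * card (relations v S)"
    using assms by (simp add: card_representations)
  finally show ?thesis using card_supported_on(2)[OF assms, where 'a='a] by simp
qed

lemma scale_in_combinations_iff:
  assumes "c \<noteq> 0"
  shows "c *s u \<in> combinations v S \<longleftrightarrow> u \<in> combinations v S"
proof -
  have *: "c *s u \<in> combinations v S" if u: "u \<in> combinations v S" for c u
  proof -
    obtain w where "w \<in> representations v S u"
      using u unfolding combinations_def by blast
    then have "(\<lambda>i. c * w i) \<in> representations v S (c *s u)"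
      by (auto simp: representations_def supported_on_def scale_sum_right)
    then show ?thesis by (auto simp: combinations_def)
  qed
  show ?thesis
    using *[of "c *s u" "inverse c"] *[of u c] assms by auto
qed

lemma combinations_subset:
  assumes "\<And>i. i \<in> S \<Longrightarrow> v i \<in> V"
  shows "combinations v S \<subseteq> V"
  using assms subspace_V
  by (auto simp: combinations_def representations_def intro!: subspace_sum subspace_scale)

text \<open>
  A relation on \<open>insert x S\<close> is a coefficient \<open>c\<close> at \<open>x\<close> together with a representation of
  \<open>- c *s v x\<close> on \<open>S\<close>. If \<open>v x\<close> is a combination of the others, all \<open>c\<close> contribute equally;
  otherwise only \<open>c = 0\<close> contributes.
\<close>

lemma card_relations_insert:
  assumes "finite S" "x \<notin> S"
  shows "card (relations v (insert x S)) =
    (if v x \<in> combinations v S then CARD('a) * card (relations v S) else card (relations v S))"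
proof -
  have "bij_betw (\<lambda>(c, w). w(x := c)) (SIGMA c:UNIV. representations v S ((- c) *s v x))
          (relations v (insert x S))"
  proof (rule bij_betw_byWitness[where f' = "\<lambda>w. (w x, w(x := 0))"])
    have sum_eq: "(\<Sum>i\<in>S. (if i = x then a else w i) *s v i) = (\<Sum>i\<in>S. w i *s v i)" for a w
      using assms(2) by (intro sum.cong) auto
    show "(\<lambda>(c, w). w(x := c)) ` (SIGMA c:UNIV. representations v S ((- c) *s v x))
            \<subseteq> relations v (insert x S)"
      using assms sum_eq by (auto simp: representations_def supported_on_def)
    show "(\<lambda>w. (w x, w(x := 0))) ` relations v (insert x S)
            \<subseteq> (SIGMA c:UNIV. representations v S ((- c) *s v x))"
      using assms sum_eq
      by (auto simp: representations_def supported_on_def eq_neg_iff_add_eq_0 add.commute)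
  qed (use assms(2) in \<open>auto simp: representations_def supported_on_def fun_eq_iff\<close>)
  then have "card (relations v (insert x S)) =
      (\<Sum>c\<in>UNIV. card (representations v S ((- c) *s v x)))"
    using assms(1) by (simp add: bij_betw_same_card[symmetric] finite_representations)
  also have "\<dots> = (if v x \<in> combinations v S then CARD('a) * card (relations v S)
      else card (relations v S))"
  proof (cases "v x \<in> combinations v S")
    case True
    have "card (representations v S ((- c) *s v x)) = card (relations v S)" for c
    proof (cases "c = 0")
      case False
      then have "(- c) *s v x \<in> combinations v S"
        using True by (subst scale_in_combinations_iff) auto
      then show ?thesis using assms(1) by (rule card_representations[rotated])
    qed simp
    then show ?thesis using True by simp
  next
    case False
    have "card (representations v S ((- c) *s v x)) = (if c = 0 then card (relations v S) else 0)"
      for c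
    proof (cases "c = 0")
      case c: False
      then have "(- c) *s v x \<notin> combinations v S"
        using False by (subst scale_in_combinations_iff) auto
      then show ?thesis using c by (auto simp: combinations_def)
    qed simp
    then show ?thesis using False by simp
  qed
  finally show ?thesis .
qed

text \<open>
  The relations on \<open>T\<close> form a line, and this line is already spanned by any nonzero relation on the
  smaller set \<open>S\<close>.
\<close>

lemma relations_eq_of_card_eq:
  assumes "finite T" "S \<subseteq> T" "card (relations v T) = CARD('a)" "card (relations v S) \<noteq> 1"
  shows "relations v S = relations v T"
proof -
  have "relations v S \<noteq> {\<lambda>_. 0}" using assms(4) by auto
  then obtain w where w: "w \<in> relations v S" "w \<noteq> (\<lambda>_. 0)"
    using zero_in_relations by blast
  then obtain j where j: "w j \<noteq> 0" by blast
  \<comment> \<open>The multiples of \<open>w\<close> are already as many as the relations on \<open>T\<close>.\<close>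
  have "inj (\<lambda>c i. c * w i)"
    using j by (auto simp: inj_def fun_eq_iff)
  then have card: "card (range (\<lambda>c i. c * w i)) = CARD('a)"
    by (rule card_image)
  have sub: "range (\<lambda>c i. c * w i) \<subseteq> relations v S"
    using w(1) by (auto simp: representations_def supported_on_def
        simp flip: scale_scale scale_sum_right)
  have le: "relations v S \<subseteq> relations v T"
    using relations_mono[OF assms(1,2)] by blast
  have "CARD('a) \<le> card (relations v S)"
    using card sub card_mono finite_representations assms(1,2) finite_subset by metis
  then show ?thesis
    using le assms(1,3) by (intro card_seteq) (auto simp: finite_representations)
qed

section \<open>A diamond-free family on three consecutive layers\<close>

text \<open>
  The middle layer is indexed by \<open>Suc k\<close>, to avoid a truncated subtraction in the lower one.
\<close>

definition rank_family :: "('i \<Rightarrow> 'b) \<Rightarrow> 'i set \<Rightarrow> nat \<Rightarrow> 'i set set" where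
  "rank_family v N k =
     {S \<in> Pow N. card S = k \<and> card (relations v S) \<noteq> CARD('a)} \<union>
     {S \<in> Pow N. card S = Suc k \<and> card (relations v S) \<noteq> 1} \<union>
     {S \<in> Pow N. card S = Suc (Suc k) \<and> card (relations v S) = CARD('a)}"

text \<open>
  The only relation on \<open>C\<close>, up to scaling, is supported on \<open>X\<close> and on \<open>Y\<close>. If \<open>X \<noteq> Y\<close>, it is
  supported on \<open>X \<inter> Y = A\<close>, which gives \<open>A\<close> the one nullity that its layer forbids.
\<close>

lemma rank_family_diamond_free:
  assumes "finite N" and mem: "{A, X, Y, C} \<subseteq> rank_family v N k"
    and less: "A \<subset> X" "A \<subset> Y" "X \<subset> C" "Y \<subset> C"
  shows "X = Y"
proof (rule ccontr)
  assume "X \<noteq> Y"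
  have in_family: "A \<in> rank_family v N k" "X \<in> rank_family v N k"
      "Y \<in> rank_family v N k" "C \<in> rank_family v N k"
    using mem by auto
  have "finite S" "k \<le> card S" "card S \<le> Suc (Suc k)" if "S \<in> rank_family v N k" for S
    using that assms(1) by (auto simp: rank_family_def intro: finite_subset)
  note fin = this(1)[OF in_family(1)] this(1)[OF in_family(2)]
      this(1)[OF in_family(3)] this(1)[OF in_family(4)]
    and bounds = this(2)[OF in_family(1)] this(3)[OF in_family(4)]
  \<comment> \<open>A chain of three sets in three layers meets every layer once.\<close>
  have "card A < card X" "card A < card Y" "card X < card C" "card Y < card C"
    using less fin by (simp_all add: psubset_card_mono)
  then have cards: "card A = k" "card X = Suc k" "card Y = Suc k" "card C = Suc (Suc k)"
    using bounds by linarith+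
  have "card (X \<inter> Y) < card X"
    using \<open>X \<noteq> Y\<close> fin cards by (metis card_subset_eq inf_le1 inf_le2 le_neq_implies_less card_mono)
  then have "card (X \<inter> Y) \<le> card A" using cards by simp
  then have A: "A = X \<inter> Y" using less fin by (intro card_seteq) auto
  have nullity: "card (relations v A) \<noteq> CARD('a)" "card (relations v X) \<noteq> 1"
      "card (relations v Y) \<noteq> 1" "card (relations v C) = CARD('a)"
    using in_family cards by (simp_all add: rank_family_def)
  have "relations v X = relations v C" "relations v Y = relations v C"
    using less nullity fin relations_eq_of_card_eq[of C X v] relations_eq_of_card_eq[of C Y v]
    by (auto simp only: psubset_imp_subset simp_thms)
  moreover have "relations v A = relations v X \<inter> relations v Y"
    using relations_mono[of C A v] relations_mono[of C X v] relations_mono[of C Y v] less fin A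
    by (auto simp: supported_on_def)
  ultimately show False using nullity by simp
qed

section \<open>The average size of the family\<close>

text \<open>
  The transition rule when the vector at \<open>x\<close> is drawn last: the nullity grows by one exactly when
  the new vector falls into the span of the old ones, and the size of that span is determined by
  the old nullity.
\<close>

lemma card_independent_extensions:
  assumes "finite S" "x \<notin> S" "g \<in> S \<rightarrow>\<^sub>E V"
  shows "real (card {y \<in> V. card (relations (g(x := y)) (insert x S)) = 1}) =
    (if card (relations g S) = 1 then real (card V) - real CARD('a) ^ card S else 0)"
    and "real (card {y \<in> V. card (relations (g(x := y)) (insert x S)) = CARD('a)}) =
    (if card (relations g S) = 1 then real CARD('a) ^ card S else 0) +
    (if card (relations g S) = CARD('a)
     then real (card V) - real CARD('a) ^ card S / real CARD('a) else 0)"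
proof -
  let ?r = "card (relations g S)" and ?K = "combinations g S"
  have sub: "?K \<subseteq> V" using assms(3) by (intro combinations_subset) auto
  then have finK: "finite ?K" using finite_V finite_subset by blast
  have step: "card (relations (g(x := y)) (insert x S)) =
      (if y \<in> ?K then CARD('a) * ?r else ?r)" for y
  proof -
    have eq: "representations (g(x := y)) S u = representations g S u" for u
      using assms(2) by (intro representations_cong) auto
    then have "combinations (g(x := y)) S = ?K" by (simp add: combinations_def)
    then show ?thesis using card_relations_insert[OF assms(1,2)] eq by simp
  qed
  have r: "?r > 0" using assms(1) by (rule card_relations_pos)
  have K: "card ?K * ?r = CARD('a) ^ card S" using assms(1) by (rule card_combinations)
  have diff: "real (card (V - ?K)) = real (card V) - real (card ?K)"
    using sub finite_V finK by (simp add: card_Diff_subset card_mono of_nat_diff)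
  have q: "CARD('a) > 1" by (rule card_field_gt_1)
  show "real (card {y \<in> V. card (relations (g(x := y)) (insert x S)) = 1}) =
    (if ?r = 1 then real (card V) - real CARD('a) ^ card S else 0)"
  proof (cases "?r = 1")
    case True
    have "{y \<in> V. card (relations (g(x := y)) (insert x S)) = 1} = V - ?K"
      using True q by (auto simp: step)
    moreover have "real (card ?K) = real CARD('a) ^ card S"
      using K True by (simp flip: of_nat_power)
    ultimately show ?thesis using True diff by simp
  next
    case False
    have none: "{y \<in> V. card (relations (g(x := y)) (insert x S)) = 1} = {}"
      using False q by (auto simp: step)
    show ?thesis unfolding none using False by simp
  qed
  show "real (card {y \<in> V. card (relations (g(x := y)) (insert x S)) = CARD('a)}) =
    (if ?r = 1 then real CARD('a) ^ card S else 0) +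
    (if ?r = CARD('a) then real (card V) - real CARD('a) ^ card S / real CARD('a) else 0)"
  proof -
    consider "?r = 1" | "?r = CARD('a)" | "?r \<noteq> 1" "?r \<noteq> CARD('a)" by blast
    then show ?thesis
    proof cases
      case 1
      have "{y \<in> V. card (relations (g(x := y)) (insert x S)) = CARD('a)} = ?K"
        using 1 q sub by (auto simp: step)
      moreover have "real (card ?K) = real CARD('a) ^ card S"
        using K 1 by (simp flip: of_nat_power)
      ultimately show ?thesis using 1 q by simp
    next
      case 2
      have "{y \<in> V. card (relations (g(x := y)) (insert x S)) = CARD('a)} = V - ?K"
        using 2 q by (auto simp: step)
      moreover have "real (card ?K) * real CARD('a) = real CARD('a) ^ card S"
        using K 2 by (simp flip: of_nat_power of_nat_mult)
      then have "real (card ?K) = real CARD('a) ^ card S / real CARD('a)"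
        using q by (simp add: field_simps)
      ultimately show ?thesis using 2 q diff by simp
    next
      case 3
      have none: "{y \<in> V. card (relations (g(x := y)) (insert x S)) = CARD('a)} = {}"
        using 3 q r by (auto simp: step)
      show ?thesis unfolding none using 3 by simp
    qed
  qed
qed

lemma card_tuples_by_nullity:
  assumes "finite S"
  shows "real (card {v \<in> S \<rightarrow>\<^sub>E V. card (relations v S) = 1}) =
      real (card V) ^ card S * independence_density (real CARD('a)) (real (card V)) (card S)"
    and "real (card {v \<in> S \<rightarrow>\<^sub>E V. card (relations v S) = CARD('a)}) =
      real (card V) ^ card S * nullity_one_density (real CARD('a)) (real (card V)) (card S)"
  using assms
proof (induction S)
  case empty
  have *: "relations v {} = {\<lambda>_. 0}" for v :: "'c \<Rightarrow> 'b"
    by (auto simp: representations_def supported_on_def)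
  {
    case 1 show ?case by (simp add: * independence_density_def)
  next
    case 2 show ?case using card_field_gt_1 by (simp add: *)
  }
next
  case (insert x S)
  let ?q = "real CARD('a)" and ?Q = "real (card V)" and ?m = "card S"
  have fin: "finite (S \<rightarrow>\<^sub>E V)" using insert.hyps finite_V by (simp add: finite_PiE)
  have sum_if: "(\<Sum>g\<in>S \<rightarrow>\<^sub>E V. if R g then c else 0) = real (card {g \<in> S \<rightarrow>\<^sub>E V. R g}) * c"
    for R and c :: real
    using fin by (simp flip: sum.inter_filter)
  {
    case 1
    have "real (card {v \<in> insert x S \<rightarrow>\<^sub>E V. card (relations v (insert x S)) = 1})
        = (\<Sum>g\<in>S \<rightarrow>\<^sub>E V. if card (relations g S) = 1 then ?Q - ?q ^ ?m else 0)"
      using insert.hyps finite_V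
      by (simp add: card_PiE_insert_filter card_independent_extensions(1)[unfolded One_nat_def]
          cong: sum.cong)
    also have "\<dots> = ?Q ^ ?m * independence_density ?q ?Q ?m * (?Q - ?q ^ ?m)"
      by (simp only: sum_if insert.IH(1))
    also have "\<dots> = ?Q ^ Suc ?m * independence_density ?q ?Q (Suc ?m)"
      using Q_pos by (simp add: independence_density_def field_simps)
    finally show ?case using insert.hyps by simp
  next
    case 2
    have "real (card {v \<in> insert x S \<rightarrow>\<^sub>E V. card (relations v (insert x S)) = CARD('a)})
        = (\<Sum>g\<in>S \<rightarrow>\<^sub>E V. (if card (relations g S) = 1 then ?q ^ ?m else 0) +
            (if card (relations g S) = CARD('a) then ?Q - ?q ^ ?m / ?q else 0))"
      using insert.hyps finite_V
      by (simp add: card_PiE_insert_filter card_independent_extensions(2)[unfolded One_nat_def]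
          cong: sum.cong)
    also have "\<dots> = ?Q ^ ?m * (?q ^ ?m * independence_density ?q ?Q ?m +
        (?Q - ?q ^ ?m / ?q) * nullity_one_density ?q ?Q ?m)"
      by (simp only: sum.distrib sum_if insert.IH) (simp only: algebra_simps)
    also have "\<dots> = ?Q ^ Suc ?m * nullity_one_density ?q ?Q (Suc ?m)"
      using nullity_one_density_step[of ?q ?Q ?m] Q_pos card_field_gt_1
      by (simp del: nullity_one_density.simps)
    finally show ?case using insert.hyps by simp
  }
qed

lemma card_assignments_by_nullity:
  assumes "finite N" "S \<subseteq> N"
  shows "real (card {v \<in> N \<rightarrow>\<^sub>E V. card (relations v S) = 1}) =
      real (card V) ^ card N * independence_density (real CARD('a)) (real (card V)) (card S)"
    and "real (card {v \<in> N \<rightarrow>\<^sub>E V. card (relations v S) = CARD('a)}) =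
      real (card V) ^ card N * nullity_one_density (real CARD('a)) (real (card V)) (card S)"
proof -
  have fin: "finite S" "finite (N - S)" and N: "S \<union> (N - S) = N"
    using assms finite_subset by auto
  have extend: "real (card {v \<in> N \<rightarrow>\<^sub>E V. card (relations v S) = j}) =
      real (card V) ^ card (N - S) * real (card {v \<in> S \<rightarrow>\<^sub>E V. card (relations v S) = j})" for j
  proof -
    have "card {v \<in> S \<union> (N - S) \<rightarrow>\<^sub>E V. card (relations v S) = j} =
        card V ^ card (N - S) * card {v \<in> S \<rightarrow>\<^sub>E V. card (relations v S) = j}"
    proof (rule card_PiE_filter_local)
      fix v v' :: "'c \<Rightarrow> 'b"
      assume "\<And>i. i \<in> S \<Longrightarrow> v i = v' i"
      then have "relations v S = relations v' S" by (rule representations_cong)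
      then show "(card (relations v S) = j) = (card (relations v' S) = j)" by simp
    qed (use fin finite_V in auto)
    then show ?thesis unfolding N by simp
  qed
  have pow: "real (card V) ^ card (N - S) * (real (card V) ^ card S * c) = real (card V) ^ card N * c"
    for c
    using assms fin card_mono[OF assms]
    by (simp add: card_Diff_subset flip: power_add mult.assoc)
  show "real (card {v \<in> N \<rightarrow>\<^sub>E V. card (relations v S) = 1}) =
      real (card V) ^ card N * independence_density (real CARD('a)) (real (card V)) (card S)"
    by (simp only: extend card_tuples_by_nullity(1)[OF fin(1)] pow)
  show "real (card {v \<in> N \<rightarrow>\<^sub>E V. card (relations v S) = CARD('a)}) =
      real (card V) ^ card N * nullity_one_density (real CARD('a)) (real (card V)) (card S)"
    by (simp only: extend card_tuples_by_nullity(2)[OF fin(1)] pow)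
qed

lemma sum_card_level:
  assumes "finite N"
    and "\<And>S. S \<subseteq> N \<Longrightarrow> card S = m \<Longrightarrow> real (card {v \<in> N \<rightarrow>\<^sub>E V. R v S}) = c"
  shows "(\<Sum>v\<in>N \<rightarrow>\<^sub>E V. real (card {S \<in> Pow N. card S = m \<and> R v S})) =
    real (card N choose m) * c"
proof -
  let ?L = "{S. S \<subseteq> N \<and> card S = m}"
  have finL: "finite ?L" using assms(1) by simp
  have fin: "finite (N \<rightarrow>\<^sub>E V)" using assms(1) finite_V by (simp add: finite_PiE)
  have "(\<Sum>v\<in>N \<rightarrow>\<^sub>E V. real (card {S \<in> Pow N. card S = m \<and> R v S}))
      = (\<Sum>v\<in>N \<rightarrow>\<^sub>E V. \<Sum>S\<in>?L. if R v S then 1 else 0)"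
    using finL by (intro sum.cong) (auto simp flip: sum.inter_filter intro: arg_cong[where f = card])
  also have "\<dots> = (\<Sum>S\<in>?L. \<Sum>v\<in>N \<rightarrow>\<^sub>E V. if R v S then 1 else 0)"
    by (rule sum.swap)
  also have "\<dots> = (\<Sum>S\<in>?L. c)"
    using fin assms(2) by (intro sum.cong) (auto simp flip: sum.inter_filter)
  also have "\<dots> = real (card N choose m) * c"
    using assms(1) by (simp add: n_subsets)
  finally show ?thesis .
qed

text \<open>
  The left-hand side is the average of \<open>card (rank_family v N k)\<close> over all assignments \<open>v\<close> of vectors
  in \<open>V\<close> to the elements of \<open>N\<close>, computed layer by layer.
\<close>

lemma exists_large_rank_family:
  fixes N :: "'i set"
  assumes "finite N"
  defines "d0 \<equiv> independence_density (real CARD('a)) (real (card V))"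
    and "d1 \<equiv> nullity_one_density (real CARD('a)) (real (card V))"
  shows "\<exists>v. real (card N choose k) * (1 - d1 k) + real (card N choose Suc k) * (1 - d0 (Suc k)) +
    real (card N choose Suc (Suc k)) * d1 (Suc (Suc k)) \<le> real (card (rank_family v N k))"
proof (rule ccontr)
  let ?\<Omega> = "N \<rightarrow>\<^sub>E V" and ?M = "real (card V) ^ card N"
  let ?avg = "real (card N choose k) * (1 - d1 k) + real (card N choose Suc k) * (1 - d0 (Suc k)) +
    real (card N choose Suc (Suc k)) * d1 (Suc (Suc k))"
  assume "\<not> (\<exists>v. ?avg \<le> real (card (rank_family v N k)))"
  then have less: "real (card (rank_family v N k)) < ?avg" for v by (simp add: not_le)
  have fin: "finite ?\<Omega>" using assms(1) finite_V by (simp add: finite_PiE)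
  have card_\<Omega>: "real (card ?\<Omega>) = ?M" using assms(1) by (simp add: card_PiE)
  then have "real (card ?\<Omega>) > 0" using Q_pos by simp
  then have ne: "?\<Omega> \<noteq> {}" by auto
  have compl: "real (card {v \<in> ?\<Omega>. \<not> R v}) = ?M - real (card {v \<in> ?\<Omega>. R v})" for R
  proof -
    have "card ({v \<in> ?\<Omega>. R v} \<union> {v \<in> ?\<Omega>. \<not> R v}) =
        card {v \<in> ?\<Omega>. R v} + card {v \<in> ?\<Omega>. \<not> R v}"
      using fin by (intro card_Un_disjoint) auto
    moreover have "{v \<in> ?\<Omega>. R v} \<union> {v \<in> ?\<Omega>. \<not> R v} = ?\<Omega>" by auto
    ultimately show ?thesis using card_\<Omega> by simp
  qed
  let ?A = "\<lambda>v. {S \<in> Pow N. card S = k \<and> card (relations v S) \<noteq> CARD('a)}"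
    and ?B = "\<lambda>v. {S \<in> Pow N. card S = Suc k \<and> card (relations v S) \<noteq> 1}"
    and ?C = "\<lambda>v. {S \<in> Pow N. card S = Suc (Suc k) \<and> card (relations v S) = CARD('a)}"
  have split: "real (card (rank_family v N k)) =
      real (card (?A v)) + real (card (?B v)) + real (card (?C v))" for v
  proof -
    have "card (?A v \<union> ?B v \<union> ?C v) = card (?A v \<union> ?B v) + card (?C v)"
      using assms(1) by (intro card_Un_disjoint) auto
    moreover have "card (?A v \<union> ?B v) = card (?A v) + card (?B v)"
      using assms(1) by (intro card_Un_disjoint) auto
    ultimately show ?thesis by (simp only: rank_family_def of_nat_add)
  qed
  have "(\<Sum>v\<in>?\<Omega>. real (card (?A v))) = real (card N choose k) * (?M * (1 - d1 k))"
    using card_assignments_by_nullity(2)[OF assms(1)]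
    by (intro sum_card_level[OF assms(1)]) (simp only: compl d1_def right_diff_distrib mult_1_right)
  moreover have "(\<Sum>v\<in>?\<Omega>. real (card (?B v))) =
      real (card N choose Suc k) * (?M * (1 - d0 (Suc k)))"
    using card_assignments_by_nullity(1)[OF assms(1)]
    by (intro sum_card_level[OF assms(1)]) (simp only: compl d0_def right_diff_distrib mult_1_right)
  moreover have "(\<Sum>v\<in>?\<Omega>. real (card (?C v))) =
      real (card N choose Suc (Suc k)) * (?M * d1 (Suc (Suc k)))"
    using card_assignments_by_nullity(2)[OF assms(1)]
    by (intro sum_card_level[OF assms(1)]) (simp only: d1_def)
  ultimately have "(\<Sum>v\<in>?\<Omega>. real (card (rank_family v N k))) =
      real (card N choose k) * (?M * (1 - d1 k)) +
      real (card N choose Suc k) * (?M * (1 - d0 (Suc k))) +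
      real (card N choose Suc (Suc k)) * (?M * d1 (Suc (Suc k)))"
    by (simp only: split sum.distrib)
  also have "\<dots> = real (card ?\<Omega>) * ?avg"
    by (simp only: card_\<Omega>) (simp only: algebra_simps)
  also have "\<dots> = (\<Sum>v\<in>?\<Omega>. ?avg)" by simp
  finally show False
    using sum_strict_mono[OF fin ne, of "\<lambda>v. real (card (rank_family v N k))" "\<lambda>_. ?avg"] less
    by simp
qed

end

section \<open>Asymptotics over the field with four elements\<close>

text \<open>
  Coordinate vectors over an index set \<open>I\<close>, taken as functions vanishing outside \<open>I\<close>, so that the
  dimension can vary within one type.
\<close>

lemma finite_vector_space_supported_on:
  assumes "finite I"
  shows "finite_vector_space (\<lambda>(c :: 'a::{field,finite}) u i. c * u i) (supported_on I)"
proof -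
  interpret vector_space "\<lambda>(c :: 'a) (u :: 'b \<Rightarrow> 'a) i. c * u i"
    by unfold_locales (auto simp: fun_eq_iff algebra_simps)
  show ?thesis
    using card_supported_on(1)[OF assms, where 'a='a]
    by unfold_locales (auto simp: subspace_def supported_on_def)
qed

definition euler_partial :: "nat \<Rightarrow> real" where
  "euler_partial d = (\<Prod>i<d. 1 - 1 / 4 ^ Suc i)"

text \<open>
  In dimension \<open>m + j\<close> the \<open>m\<close> factors are \<open>1 - 1 / 4 ^ i\<close> for \<open>j < i \<le> m + j\<close>; the factors with
  \<open>i \<le> j\<close> complete the Euler product.
\<close>

lemma independence_density_4:
  "independence_density 4 (4 ^ (m + j)) m * euler_partial j = euler_partial (m + j)"
proof (induction m arbitrary: j)
  case (Suc m)
  have "independence_density 4 (4 ^ (Suc m + j)) (Suc m) * euler_partial j =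
      independence_density 4 (4 ^ (m + Suc j)) m * ((1 - 4 ^ m / 4 ^ (Suc m + j)) * euler_partial j)"
    by (simp add: independence_density_def)
  also have "(1 - 4 ^ m / 4 ^ (Suc m + j)) * euler_partial j = euler_partial (Suc j)"
    by (simp add: euler_partial_def power_add)
  finally show ?case using Suc.IH[of "Suc j"] by simp
qed (simp add: independence_density_def)

lemma not_contains_diamond:
  assumes "\<And>A X Y C. {A, X, Y, C} \<subseteq> F \<Longrightarrow> A \<subset> X \<Longrightarrow> A \<subset> Y \<Longrightarrow> X \<subset> C \<Longrightarrow> Y \<subset> C \<Longrightarrow> X = Y"
  shows "\<not> contains_weak_copy F TYPE(diamond)"
proof
  assume "contains_weak_copy F TYPE(diamond)"
  then obtain \<psi> :: "diamond \<Rightarrow> nat set"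
    where \<psi>: "inj \<psi>" "range \<psi> \<subseteq> F" "strict_mono \<psi>"
    unfolding contains_weak_copy_def by blast
  have less: "\<psi> p \<subset> \<psi> r" if "p < r" for p r
    using \<psi>(3) that by (rule strict_monoD)
  have "\<psi> D_x = \<psi> D_y"
  proof (rule assms)
    show "{\<psi> D_b, \<psi> D_x, \<psi> D_y, \<psi> D_c} \<subseteq> F" using \<psi>(2) by blast
  qed (rule less, simp add: less_diamond_def less_eq_diamond_def)+
  then show False using \<psi>(1) by (auto dest: injD)
qed

lemma La_ge:
  assumes "F \<subseteq> Pow {1..n}" "\<not> contains_weak_copy F P"
  shows "card F \<le> La n P"
  unfolding La_def using assms La_family_finite_nonempty(1)[of n P] by (intro Max_ge) auto

text \<open>
  The family in dimension \<open>d\<close> on the layers \<open>d - 1\<close>, \<open>d\<close> and \<open>d + 1\<close>. The constant \<open>64 / 45\<close> is the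
  inverse of \<open>(1 - 1/4) * (1 - 1/16)\<close>, the two Euler factors that are missing for \<open>d - 2\<close> independent
  vectors.
\<close>

lemma La_diamond_ge:
  assumes "d \<ge> 2"
  shows "real (La n TYPE(diamond)) \<ge>
    real (n choose (d - 1)) * (1 - 64 / 45 * euler_partial d * ((1 / 4 - 1 / 4 ^ d) / 3)) +
    real (n choose d) * (1 - euler_partial d) +
    real (n choose Suc d) * (euler_partial d * ((4 - 1 / 4 ^ d) / 3))"
proof -
  obtain j where "d = 2 + j" using assms le_Suc_ex by blast
  then have d: "d = Suc (Suc j)" by simp
  interpret finite_vector_space "\<lambda>(c :: gf4) (u :: nat \<Rightarrow> gf4) i. c * u i" "supported_on {..<d}"
    by (rule finite_vector_space_supported_on) simp
  have Q: "real (card (supported_on {..<d} :: (nat \<Rightarrow> gf4) set)) = 4 ^ d"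
    using card_supported_on(2)[of "{..<d}", where 'a=gf4] by (simp add: card_gf4)
  have dens: "independence_density 4 (4 ^ d) j = 64 / 45 * euler_partial d"
    using independence_density_4[of j 2] by (simp add: d euler_partial_def numeral_2_eq_2)
  have dens': "independence_density 4 (4 ^ d) d = euler_partial d"
    using independence_density_4[of d 0] by (simp add: euler_partial_def)
  have below: "nullity_one_density 4 (4 ^ d) (Suc j) =
      64 / 45 * euler_partial d * ((1 / 4 - 1 / 4 ^ d) / 3)"
    unfolding nullity_one_density.simps dens by (simp add: d field_simps)
  have above: "nullity_one_density 4 (4 ^ d) (Suc d) = euler_partial d * ((4 - 1 / 4 ^ d) / 3)"
    unfolding nullity_one_density.simps dens' by (simp add: field_simps)
  obtain v where v: "real (n choose Suc j) * (1 - nullity_one_density 4 (4 ^ d) (Suc j)) +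
      real (n choose d) * (1 - independence_density 4 (4 ^ d) d) +
      real (n choose Suc d) * nullity_one_density 4 (4 ^ d) (Suc d)
      \<le> real (card (rank_family v {1..n} (Suc j)))"
    using exists_large_rank_family[of "{1..n}" "Suc j"] unfolding Q card_gf4 by (auto simp: d)
  have "card (rank_family v {1..n} (Suc j)) \<le> La n TYPE(diamond)"
  proof (intro La_ge not_contains_diamond)
    show "rank_family v {1..n} (Suc j) \<subseteq> Pow {1..n}" by (auto simp: rank_family_def)
  qed (rule rank_family_diamond_free[of "{1..n}"], auto)
  moreover have "d - 1 = Suc j" using d by simp
  ultimately show ?thesis
    using v[unfolded below above dens'] by simp
qed

lemma euler_partial_tendsto: "euler_partial \<longlonglongrightarrow> Delta4"
proof -
  have "(\<lambda>n. \<Prod>i\<le>n. 1 - 1 / 4 ^ Suc i :: real) \<longlonglongrightarrow> Delta4"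
    unfolding Delta4_def
    by (rule convergent_prod_LIMSEQ[OF has_prod_iff[THEN iffD1, OF Delta4_has_prod, THEN conjunct1]])
  then have "(\<lambda>n. euler_partial (Suc n)) \<longlonglongrightarrow> Delta4"
    by (simp add: euler_partial_def lessThan_Suc_atMost)
  then show ?thesis by (simp add: filterlim_sequentially_Suc)
qed

lemma euler_partial_pos: "euler_partial d > 0"
  unfolding euler_partial_def by (intro prod_pos) (simp add: one_less_power del: power_Suc)

lemma Delta4_upper: "Delta4 \<le> euler_partial d"
proof (rule decseq_ge[OF _ euler_partial_tendsto])
  show "decseq euler_partial"
  proof (rule decseq_SucI)
    fix d
    show "euler_partial (Suc d) \<le> euler_partial d"
      using euler_partial_pos[of d] by (simp add: euler_partial_def field_simps)
  qed
qed

text \<open>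
  The tail of the product exceeds \<open>1 - (\<Sum>i>d. 1 / 4 ^ i)\<close>, and that geometric series is
  \<open>(1 / 4) ^ d / 3\<close>. With this correction the partial products increase.
\<close>

lemma Delta4_lower: "euler_partial d * (1 - (1 / 4) ^ d / 3) \<le> Delta4"
proof (rule incseq_le)
  show "incseq (\<lambda>d. euler_partial d * (1 - (1 / 4) ^ d / 3))"
  proof (rule incseq_SucI)
    fix d
    define t :: real where "t = (1 / 4) ^ Suc d"
    have "1 - (1 / 4) ^ d / 3 \<le> (1 - t) * (1 - t / 3)"
      by (simp add: t_def field_simps)
    then have "euler_partial d * (1 - (1 / 4) ^ d / 3) \<le> euler_partial d * ((1 - t) * (1 - t / 3))"
      using euler_partial_pos[of d] by (intro mult_left_mono) auto
    also have "\<dots> = euler_partial (Suc d) * (1 - (1 / 4) ^ Suc d / 3)"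
      by (simp add: t_def euler_partial_def power_one_over)
    finally show "euler_partial d * (1 - (1 / 4) ^ d / 3)
        \<le> euler_partial (Suc d) * (1 - (1 / 4) ^ Suc d / 3)" .
  qed
  have "(\<lambda>d. euler_partial d * (1 - (1 / 4) ^ d / 3)) \<longlonglongrightarrow> Delta4 * (1 - 0 / 3)"
    by (intro tendsto_intros euler_partial_tendsto LIMSEQ_realpow_zero) auto
  then show "(\<lambda>d. euler_partial d * (1 - (1 / 4) ^ d / 3)) \<longlonglongrightarrow> Delta4" by simp
qed

lemma coefficient_approx: "\<bar>(2 + 29 / 135 * Delta4) - 2.147908\<bar> < 0.5 / 10 ^ 6"
proof -
  have e: "euler_partial 10 = (\<Prod>i\<in>{0,1,2,3,4,5,6,7,8,9}. 1 - 1 / 4 ^ Suc i)"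
    unfolding euler_partial_def by (rule prod.cong) auto
  have "0.688537 < euler_partial 10 * (1 - (1 / 4) ^ 10 / 3)" "euler_partial 10 < 0.688539"
    unfolding e by (simp_all add: field_simps)
  then have "0.688537 < Delta4" "Delta4 < 0.688539"
    using Delta4_upper[of 10] Delta4_lower[of 10] by linarith+
  then show ?thesis unfolding abs_less_iff by (intro conjI) (simp_all add: field_simps)
qed

lemma binomial_Suc_ratio:
  assumes "k \<le> n"
  shows "real (n choose Suc k) / real (n choose k) = real (n - k) / real (Suc k)"
proof -
  have "Suc k * (n choose Suc k) = (n - k) * (n choose k)"
    by (metis binomial_absorb_comp binomial_absorption)
  then have "real (Suc k) * real (n choose Suc k) = real (n - k) * real (n choose k)"
    by (metis of_nat_mult)
  moreover have "real (n choose k) > 0" using assms by simp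
  ultimately show ?thesis by (simp add: field_simps)
qed

lemma central_binomial_ratio_above:
  "(\<lambda>n. real (n choose Suc (n div 2)) / real (n choose (n div 2))) \<longlonglongrightarrow> 1"
proof (rule tendsto_sandwich)
  have eq: "real (n choose Suc (n div 2)) / real (n choose (n div 2))
      = real (n - n div 2) / real (Suc (n div 2))" for n
    by (rule binomial_Suc_ratio) simp
  have "real n / (real n + 2) \<le> real (n - n div 2) / real (Suc (n div 2))" for n
  proof -
    have "real n / (real n + 2) = (real n / 2) / (real n / 2 + 1)" by (simp add: field_simps)
    also have "\<dots> \<le> real (n - n div 2) / real (Suc (n div 2))" by (rule frac_le) linarith+
    finally show ?thesis .
  qed
  then show "\<forall>\<^sub>F n in sequentially. real n / (real n + 2) \<le>
      real (n choose Suc (n div 2)) / real (n choose (n div 2))"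
    by (intro always_eventually allI) (simp only: eq)
  have "real (n - n div 2) / real (Suc (n div 2)) \<le> 1" for n
  proof -
    have "n - n div 2 \<le> Suc (n div 2)" by linarith
    then have "real (n - n div 2) \<le> real (Suc (n div 2))" by (rule of_nat_mono)
    then show ?thesis by (simp only: divide_le_eq_1_pos of_nat_0_less_iff zero_less_Suc)
  qed
  then show "\<forall>\<^sub>F n in sequentially.
      real (n choose Suc (n div 2)) / real (n choose (n div 2)) \<le> 1"
    by (intro always_eventually allI) (simp only: eq)
  show "(\<lambda>n. real n / (real n + 2)) \<longlonglongrightarrow> 1" by real_asymp
qed simp

lemma central_binomial_ratio_below:
  "(\<lambda>n. real (n choose (n div 2 - 1)) / real (n choose (n div 2))) \<longlonglongrightarrow> 1"
proof (rule tendsto_sandwich)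
  have eq: "real (n choose (n div 2 - 1)) / real (n choose (n div 2))
      = real (n div 2) / real (Suc (n - n div 2))" if "n \<ge> 2" for n
  proof -
    have "n div 2 \<ge> 1" using that by linarith
    then have "Suc (n div 2 - 1) = n div 2" "n - (n div 2 - 1) = Suc (n - n div 2)" by linarith+
    then have "real (n choose (n div 2)) / real (n choose (n div 2 - 1))
        = real (Suc (n - n div 2)) / real (n div 2)"
      using binomial_Suc_ratio[of "n div 2 - 1" n] by simp
    then show ?thesis by (metis inverse_divide)
  qed
  have lower: "(real n - 1) / (real n + 3) \<le> real (n div 2) / real (Suc (n - n div 2))" for n
  proof -
    have "n \<le> 2 * (n div 2) + 1" "2 * (n - n div 2) \<le> n + 1" by linarith+
    then have half: "real n \<le> 2 * real (n div 2) + 1" "2 * real (n - n div 2) \<le> real n + 1"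
      by linarith+
    have "(real n - 1) / (real n + 3) = ((real n - 1) / 2) / ((real n + 1) / 2 + 1)"
      by (simp add: field_simps)
    also have "\<dots> \<le> real (n div 2) / real (Suc (n - n div 2))"
      using half by (intro frac_le) simp_all
    finally show ?thesis .
  qed
  show "\<forall>\<^sub>F n in sequentially. (real n - 1) / (real n + 3) \<le>
      real (n choose (n div 2 - 1)) / real (n choose (n div 2))"
    using eventually_ge_at_top[of 2] by eventually_elim (use lower eq in simp)
  have upper: "n div 2 \<le> Suc (n - n div 2)" for n by linarith
  show "\<forall>\<^sub>F n in sequentially.
      real (n choose (n div 2 - 1)) / real (n choose (n div 2)) \<le> 1"
    using eventually_ge_at_top[of 2] by eventually_elim (use upper eq in simp)
  show "(\<lambda>n. (real n - 1) / (real n + 3)) \<longlonglongrightarrow> 1" by real_asymp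
qed simp

theorem theorem1:
  shows "(\<exists>\<epsilon> :: nat \<Rightarrow> real. \<epsilon> \<longlonglongrightarrow> 0 \<and>
            (\<forall>n. real (La n TYPE(diamond)) \<ge>
                 (2 + 29 / 135 * Delta4 + \<epsilon> n) * real (n choose (n div 2))))
         \<and> \<bar>(2 + 29 / 135 * Delta4) - 2.147908\<bar> < 0.5 / 10 ^ 6"
proof (intro conjI exI allI)
  let ?c = "2 + 29 / 135 * Delta4"
  define L where "L n =
    real (n choose (n div 2 - 1)) / real (n choose (n div 2)) *
      (1 - 64 / 45 * euler_partial (n div 2) * ((1 / 4 - (1 / 4) ^ (n div 2)) / 3)) +
    (1 - euler_partial (n div 2)) +
    real (n choose Suc (n div 2)) / real (n choose (n div 2)) *
      (euler_partial (n div 2) * ((4 - (1 / 4) ^ (n div 2)) / 3))" for n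
  \<comment> \<open>For \<open>n < 4\<close> the dimension \<open>n div 2\<close> is below \<open>2\<close>, and the lower bound is made trivial.\<close>
  define \<epsilon> where "\<epsilon> n = (if n < 4 then - ?c else L n - ?c)" for n
  have half: "filterlim (\<lambda>n::nat. n div 2) sequentially sequentially"
    by (rule filterlim_at_top_div_const_nat) simp
  have "L \<longlonglongrightarrow> 1 * (1 - 64 / 45 * Delta4 * ((1 / 4 - 0) / 3)) + (1 - Delta4) +
      1 * (Delta4 * ((4 - 0) / 3))"
    unfolding L_def
    by (intro tendsto_intros central_binomial_ratio_below central_binomial_ratio_above
        filterlim_compose[OF euler_partial_tendsto half]
        filterlim_compose[OF LIMSEQ_realpow_zero half]) auto
  then have "L \<longlonglongrightarrow> ?c" by (simp add: algebra_simps)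
  then have "(\<lambda>n. L n - ?c) \<longlonglongrightarrow> 0" by (simp add: LIM_zero)
  moreover have "\<forall>\<^sub>F n in sequentially. L n - ?c = \<epsilon> n"
    using eventually_ge_at_top[of 4] by eventually_elim (simp add: \<epsilon>_def)
  ultimately show "\<epsilon> \<longlonglongrightarrow> 0" by (rule Lim_transform_eventually)
  fix n
  show "(?c + \<epsilon> n) * real (n choose (n div 2)) \<le> real (La n TYPE(diamond))"
  proof (cases "n < 4")
    case False
    have pos: "real (n choose (n div 2)) > 0" by simp
    have "(?c + \<epsilon> n) * real (n choose (n div 2)) = L n * real (n choose (n div 2))"
      using False by (simp add: \<epsilon>_def)
    also have "\<dots> =
      real (n choose (n div 2 - 1)) *
        (1 - 64 / 45 * euler_partial (n div 2) * ((1 / 4 - 1 / 4 ^ (n div 2)) / 3)) +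
      real (n choose (n div 2)) * (1 - euler_partial (n div 2)) +
      real (n choose Suc (n div 2)) * (euler_partial (n div 2) * ((4 - 1 / 4 ^ (n div 2)) / 3))"
      unfolding L_def power_one_over using pos by (simp only: distrib_right) simp
    also have "\<dots> \<le> real (La n TYPE(diamond))"
      using False by (intro La_diamond_ge) linarith
    finally show ?thesis .
  qed (simp add: \<epsilon>_def)
qed (rule coefficient_approx)

end
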